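(* Let $n = p_1^{\alpha_1}\cdots p_k^{\alpha_k}$ be the canonical expansion of the positive integer $n$ (as a product of powers of distinct primes $p_1,\dots,p_k$). Then $$\sum_{a=1}^{n} \left(Ns(a,n)\right)^m = \left(\varphi(n)\right)^m \prod_{i=1}^{k}\left(1 - \frac{1}{(1-p_i)^{m-1}}\right),$$ where $m$ is a non-negative integer.
   Context: For a positive integer $n$ and a non-negative integer $a$, define $$Ns(a,n) = \varphi(n)\,\frac{\mu\left(\frac{n}{(a,n)}\right)}{\varphi\left(\frac{n}{(a,n)}\right)},$$ where $\varphi$ is the Euler function, $\mu$ is the Möbius function and $(a,n)$ is the greatest common divisor of the integers $a$ and $n$.
   Formalization: For m = 0 the powers of Ns(a,n) on the left are read with 0^0 = 0; with 0^0 = 1 the identity fails for every non-squarefree n (n = 4 gives 4 on the left, 2 on the right). For m ≥ 1 nothing is changed. *)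

theory Defs
  imports Complex_Main "HOL-Number_Theory.Number_Theory" "HOL-Computational_Algebra.Squarefree"
begin

definition moebius :: "nat \<Rightarrow> int" where
  "moebius n = (if squarefree n then (-1) ^ card (prime_factors n) else 0)"

(* The division by the gcd is exact, so nat division is the true quotient.
   For a = 0 we have gcd 0 n = n. *)
definition Ns :: "nat \<Rightarrow> nat \<Rightarrow> real" where
  "Ns a n = real (totient n) * real_of_int (moebius (n div gcd a n))
              / real (totient (n div gcd a n))"

(* The power with the convention 0 ^ 0 = 0: it differs from the library power only
   there. With 0 ^ 0 = 1 the power sum of Ns a n over a = 1..n at exponent 0 would be n
   instead of the product of the primes dividing n, so the exponent 0 case of the product
   formula would fail for every n that is not squarefree. *)
definition npower :: "real \<Rightarrow> nat \<Rightarrow> real" where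
  "npower x m = (if x = 0 \<and> m = 0 then 0 else x ^ m)"

lemma npower_eq_power: "x \<noteq> 0 \<or> m > 0 \<Longrightarrow> npower x m = x ^ m"
  by (auto simp: npower_def)

end

theory Submission
  imports Defs
begin

text \<open>
  The value \<open>Ns a n\<close> depends on \<open>a\<close> only through the divisor \<open>d = n div gcd a n\<close> of \<open>n\<close>, and each
  divisor \<open>d\<close> arises from exactly \<open>totient d\<close> of the numbers \<open>1, \<dots>, n\<close>
  (\<open>sum_over_gcd_quotient\<close>).  The Moebius factor leaves only the squarefree \<open>d\<close>, which are the
  products of the sets \<open>S\<close> of prime divisors of \<open>n\<close> (\<open>bij_betw_prod_squarefree_divisors\<close>).  For such
  a \<open>d\<close> both \<open>moebius d = (-1) ^ card S\<close> and \<open>totient d = (\<Prod>p\<in>S. p - 1)\<close> split over \<open>S\<close>, so the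
  contribution of \<open>d\<close> is \<open>totient n ^ m\<close> times the product over \<open>p \<in> S\<close> of
  \<open>(p - 1) * (- 1 / (p - 1)) ^ m\<close>, which is \<open>- 1 / (1 - p) powi (m - 1)\<close> (\<open>local_factor\<close>).
  Summing a product over all subsets \<open>S\<close> of the prime divisors is the expansion of the product of
  the binomials \<open>1 - 1 / (1 - p) powi (m - 1)\<close>, which is the right-hand side.

  At exponent \<open>0\<close> every nonzero term counts \<open>1\<close>, while the terms with \<open>d\<close> not squarefree must still
  vanish; this is where the convention \<open>npower 0 0 = 0\<close> enters.
\<close>

text \<open>
  For a divisor \<open>d\<close> of \<open>n\<close>, the \<open>a\<close> with quotient \<open>d\<close> are those with \<open>gcd a n = n div d\<close>, that is,
  the multiples of \<open>n div d\<close> by the numbers up to \<open>d\<close> that are coprime to \<open>d\<close>.  With \<open>F = 1\<close> this is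
  Gauss's divisor sum for the totient.
\<close>
lemma sum_over_gcd_quotient:
  fixes F :: "nat \<Rightarrow> 'a :: semiring_1"
  assumes "n > 0"
  shows "(\<Sum>a = 1..n. F (n div gcd a n)) = (\<Sum>d | d dvd n. of_nat (totient d) * F d)"
proof -
  let ?q = "\<lambda>a. n div gcd a n"
  have "(\<Sum>a = 1..n. F (?q a)) = (\<Sum>d | d dvd n. \<Sum>a | a \<in> {1..n} \<and> ?q a = d. F (?q a))"
  proof (rule sum.group[symmetric])
    show "?q ` {1..n} \<subseteq> {d. d dvd n}"
      by (auto intro!: div_dvd_iff_mult[THEN iffD2])
  qed (use assms in auto)
  also have "\<dots> = (\<Sum>d | d dvd n. of_nat (totient d) * F d)"
  proof (rule sum.cong[OF refl])
    fix d assume "d \<in> {d. d dvd n}"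
    then have d: "d dvd n" by simp
    have "?q a = d \<longleftrightarrow> gcd a n = n div d" for a
    proof -
      have "gcd a n * ?q a = n" and "(n div d) * d = n" using d by simp_all
      then show ?thesis
        using assms by (metis mult_cancel_left mult_cancel_right less_not_refl2 mult_is_0)
    qed
    then have "card {a. a \<in> {1..n} \<and> ?q a = d} = card {a \<in> {0<..n}. gcd a n = n div d}"
      by (intro arg_cong[of _ _ card]) auto
    also have "\<dots> = totient d"
    proof -
      have "n div d dvd n" and "n div (n div d) = d"
        using d assms by (auto elim!: dvdE)
      then show ?thesis
        using card_gcd_eq_totient[of n "n div d"] assms by simp
    qed
    finally show "(\<Sum>a | a \<in> {1..n} \<and> ?q a = d. F (?q a)) = of_nat (totient d) * F d"
      by simp
  qed
  finally show ?thesis .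
qed

lemma prime_factors_prod_primes:
  fixes S :: "nat set"
  assumes "finite S" "\<And>p. p \<in> S \<Longrightarrow> prime p"
  shows "prime_factors (\<Prod>S) = S"
proof -
  have "prime_factorization (prod_mset (mset_set S)) = mset_set S"
    using assms by (intro prime_factorization_prod_mset_primes) auto
  then show ?thesis
    using assms by (simp add: prod_unfold_prod_mset)
qed

lemma squarefree_prod_primes:
  fixes S :: "nat set"
  assumes "\<And>p. p \<in> S \<Longrightarrow> prime p"
  shows "squarefree (\<Prod>S)"
  using assms by (intro squarefree_prod_coprime) (auto intro: squarefree_prime primes_coprime)

text \<open>
  Unique factorisation: a squarefree number has all multiplicities equal to \<open>1\<close>, so taking prime
  factors inverts taking the product.  This turns a sum over squarefree divisors into a sum over
  a power set, to which the expansion of a product of binomials applies.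
\<close>
lemma bij_betw_prod_squarefree_divisors:
  fixes n :: nat
  assumes "n > 0"
  shows "bij_betw (\<lambda>S. \<Prod>S) (Pow (prime_factors n)) {d. d dvd n \<and> squarefree d}"
proof (rule bij_betw_byWitness[where f' = prime_factors])
  have S: "finite S" "\<And>p. p \<in> S \<Longrightarrow> prime p" if "S \<subseteq> prime_factors n" for S
    using that by (auto intro: finite_subset)
  show "\<forall>S \<in> Pow (prime_factors n). prime_factors (\<Prod>S) = S"
    using S by (auto simp: prime_factors_prod_primes)
  show "\<forall>d \<in> {d. d dvd n \<and> squarefree d}. \<Prod>(prime_factors d) = d"
  proof clarify
    fix d assume "d dvd n" "squarefree d"
    with assms have "d \<noteq> 0" by auto
    then have "d = (\<Prod>p\<in>prime_factors d. p ^ multiplicity p d)"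
      by (intro prime_factorization_nat) auto
    also have "\<dots> = \<Prod>(prime_factors d)"
      using \<open>squarefree d\<close> \<open>d \<noteq> 0\<close> by (intro prod.cong) (auto simp: squarefree_factorial_semiring')
    finally show "\<Prod>(prime_factors d) = d" ..
  qed
  show "(\<lambda>S. \<Prod>S) ` Pow (prime_factors n) \<subseteq> {d. d dvd n \<and> squarefree d}"
  proof clarify
    fix S assume sub: "S \<subseteq> prime_factors n"
    have "mset_set S \<subseteq># prime_factorization n"
      using sub subset_imp_msubset_mset_set[of S "prime_factors n"]
        mset_set_set_mset_msubset[of "prime_factorization n"]
      by (auto intro: subset_mset.trans)
    then have "\<Prod>S dvd n"
      using prod_mset_subset_imp_dvd[of "mset_set S" "prime_factorization n"] assms
      by (simp add: prod_unfold_prod_mset prod_mset_prime_factorization_nat)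
    then show "\<Prod>S dvd n \<and> squarefree (\<Prod>S)"
      using S[OF sub] by (simp add: squarefree_prod_primes)
  qed
  show "prime_factors ` {d. d dvd n \<and> squarefree d} \<subseteq> Pow (prime_factors n)"
    using assms by (auto intro: dvd_trans simp: prime_factors_dvd)
qed

lemma totient_prod_primes:
  fixes S :: "nat set"
  assumes "\<And>p. p \<in> S \<Longrightarrow> prime p"
  shows "real (totient (\<Prod>S)) = (\<Prod>p\<in>S. real p - 1)"
proof -
  have "totient (\<Prod>S) = (\<Prod>p\<in>S. totient p)"
    using assms by (intro totient_prod_coprime) (auto simp: pairwise_def intro: primes_coprime)
  moreover have "real (totient p) = real p - 1" if "p \<in> S" for p
    using assms[OF that] prime_ge_1_nat[of p] by (simp add: totient_prime of_nat_diff)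
  ultimately show ?thesis by simp
qed

lemma moebius_prod_primes:
  assumes "finite S" "\<And>p. p \<in> S \<Longrightarrow> prime p"
  shows "moebius (\<Prod>S) = (-1) ^ card S"
  using assms by (simp add: moebius_def prime_factors_prod_primes squarefree_prod_primes)

text \<open>
  The factor \<open>x - 1\<close>, coming from the number of terms, cancels one of the \<open>m\<close> powers.  The integer
  power makes this true at \<open>m = 0\<close> as well, where both sides are \<open>x - 1\<close>.
\<close>
lemma local_factor:
  fixes x :: real
  assumes "x \<noteq> 1"
  shows "(x - 1) * (- 1 / (x - 1)) ^ m = - (1 / (1 - x) powi (int m - 1))"
proof -
  have "- 1 / (x - 1) = inverse (1 - x)"
    using assms by (simp add: field_simps)
  moreover have "1 / (1 - x) powi (int m - 1) = (1 - x) * inverse (1 - x) ^ m"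
    using assms by (simp add: power_int_diff power_inverse divide_inverse)
  ultimately show ?thesis
    by (simp add: algebra_simps)
qed

text \<open>
  The joint contribution of all \<open>a\<close> whose quotient is the squarefree number \<open>d\<close>.  Its base is nonzero,
  so \<open>npower\<close> is the ordinary, multiplicative power and the term splits over the primes of \<open>d\<close>.
\<close>
lemma squarefree_divisor_term:
  assumes "finite S" "\<And>p. p \<in> S \<Longrightarrow> prime p" "n > 0"
  defines "d \<equiv> \<Prod>S"
  shows "real (totient d) * npower (real (totient n) * real_of_int (moebius d) / real (totient d)) m
       = real (totient n) ^ m * (\<Prod>p\<in>S. - (1 / (1 - real p) powi (int m - 1)))"
proof -
  have gt: "real p > 1" if "p \<in> S" for p
    using assms(2)[OF that] prime_gt_1_nat by fastforce
  have phi: "real (totient d) = (\<Prod>p\<in>S. real p - 1)"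
    unfolding d_def using assms(2) by (rule totient_prod_primes)
  have moeb: "real_of_int (moebius d) = (\<Prod>p\<in>S. - 1)"
    unfolding d_def using assms(1,2) by (simp add: moebius_prod_primes)
  have ratio: "real_of_int (moebius d) / real (totient d) = (\<Prod>p\<in>S. - 1 / (real p - 1))"
    by (simp only: phi moeb prod_dividef)
  have "(\<Prod>p\<in>S. - 1 / (real p - 1)) \<noteq> 0"
    using gt assms(1) by force
  then have "npower (real (totient n) * real_of_int (moebius d) / real (totient d)) m
      = (real (totient n) * (\<Prod>p\<in>S. - 1 / (real p - 1))) ^ m"
    using assms(3) by (simp add: npower_eq_power ratio flip: times_divide_eq_right)
  then have "real (totient d) * npower (real (totient n) * real_of_int (moebius d) / real (totient d)) m
      = real (totient n) ^ m * (\<Prod>p\<in>S. (real p - 1) * (- 1 / (real p - 1)) ^ m)"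
    by (simp only: phi prod.distrib prod_power_distrib power_mult_distrib mult_ac)
  also have "(\<Prod>p\<in>S. (real p - 1) * (- 1 / (real p - 1)) ^ m)
      = (\<Prod>p\<in>S. - (1 / (1 - real p) powi (int m - 1)))"
    using gt by (intro prod.cong refl local_factor) force
  finally show ?thesis .
qed

text \<open>
  The formula indexed by the set of prime divisors: the exponents of the primes in \<open>n\<close> enter only
  through \<open>totient n\<close>.
\<close>
theorem power_sum_Ns:
  assumes "n > 0"
  shows "(\<Sum>a = 1..n. npower (Ns a n) m) =
         real (totient n) ^ m *
           (\<Prod>p\<in>prime_factors n. 1 - 1 / (1 - real p) powi (int m - 1))"
proof -
  let ?T = "\<lambda>d. real (totient d) *
                  npower (real (totient n) * real_of_int (moebius d) / real (totient d)) m"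
  let ?g = "\<lambda>p::nat. - (1 / (1 - real p) powi (int m - 1))"
  have "(\<Sum>a = 1..n. npower (Ns a n) m) = (\<Sum>d | d dvd n. ?T d)"
    unfolding Ns_def by (rule sum_over_gcd_quotient[OF assms])
  \<comment> \<open>For \<open>m = 0\<close> the discarded terms vanish only because \<open>npower 0 0 = 0\<close>.\<close>
  also have "\<dots> = (\<Sum>d | d dvd n \<and> squarefree d. ?T d)"
    using assms by (intro sum.mono_neutral_right) (auto simp: moebius_def npower_def)
  also have "\<dots> = (\<Sum>S\<in>Pow (prime_factors n). ?T (\<Prod>S))"
    by (rule sum.reindex_bij_betw[OF bij_betw_prod_squarefree_divisors[OF assms], symmetric])
  also have "\<dots> = (\<Sum>S\<in>Pow (prime_factors n). real (totient n) ^ m * prod ?g S)"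
    using assms by (intro sum.cong refl squarefree_divisor_term) (auto intro: finite_subset)
  also have "\<dots> = real (totient n) ^ m * (\<Prod>p\<in>prime_factors n. ?g p + 1)"
    by (subst prod_add) (simp_all add: sum_distrib_left)
  finally show ?thesis by simp
qed

theorem theorem3:
  fixes n k m :: nat and p \<alpha> :: "nat \<Rightarrow> nat"
  assumes "n > 0"
    and "\<And>i. i \<in> {1..k} \<Longrightarrow> prime (p i)"
    and "\<And>i. i \<in> {1..k} \<Longrightarrow> \<alpha> i > 0"
    and "inj_on p {1..k}"
    and "n = (\<Prod>i = 1..k. p i ^ \<alpha> i)"
  shows "(\<Sum>a = 1..n. npower (Ns a n) m) =
         real (totient n) ^ m *
           (\<Prod>i = 1..k. 1 - 1 / (1 - real (p i)) powi (int m - 1))"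
proof -
  have "prime_factors n = p ` {1..k}"
  proof (intro equalityI subsetI)
    fix q assume "q \<in> prime_factors n"
    then have "prime q" "q dvd (\<Prod>i = 1..k. p i ^ \<alpha> i)"
      using assms(5) by (auto simp: prime_factors_dvd)
    then obtain i where "i \<in> {1..k}" "q dvd p i"
      by (auto simp: prime_dvd_prod_iff dest: prime_dvd_power)
    then show "q \<in> p ` {1..k}"
      using primes_dvd_imp_eq[OF \<open>prime q\<close> assms(2)] by blast
  next
    fix q assume "q \<in> p ` {1..k}"
    then obtain i where i: "i \<in> {1..k}" "q = p i" by auto
    have "p i dvd p i ^ \<alpha> i"
      using assms(3)[OF i(1)] by (intro dvd_power) simp
    also have "\<dots> dvd n"
      unfolding assms(5) using i(1) by (intro dvd_prodI) auto
    finally show "q \<in> prime_factors n"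
      using assms(1) assms(2)[OF i(1)] i(2) by (auto simp: prime_factors_dvd)
  qed
  then show ?thesis
    by (simp only: power_sum_Ns[OF assms(1)] prod.reindex[OF assms(4)] o_def)
qed

end
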